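(* Let $\nu\in\mathbb M$ be ergodic with respect to $\mathbb S\times\mathbb O$ and aperiodic. Then for every $k\ge0$ and all distinct $r_1,r_2\in\{0,\dots,2^k-1\}$, the measures $\mathcal P_{r_1,k}[\nu]$ and $\mathcal P_{r_2,k}[\nu]$ are mutually singular.
   Context: $I=\{0,1\}$. $\mathbb S$ is the left shift on $I^{\mathbb Z}$; $\mathbb S^j\eta$ denotes pushforward. $I^{\mathbb N}$ is the space of $0$–$1$ sequences $(\alpha_i)_{i\ge1}$ with uniform Bernoulli measure $m$; $\mathbb O$ is the odometer (if $\alpha_1=\dots=\alpha_{n-1}=1$, $\alpha_n=0$, then $\mathbb O[\alpha]_i=0$ for $i<n$, $\mathbb O[\alpha]_n=1$, $\mathbb O[\alpha]_i=\alpha_i$ for $i>n$). $\mathbb M$ is the set of Borel probability measures on $I^{\mathbb Z}\times I^{\mathbb N}$ invariant under $\mathbb S\times\mathbb O$. $A_{r,k}=\{\alpha:\sum_{i=1}^k\alpha_i2^{i-1}=r\}$; $\mathcal P_{r,k}[\nu]$ is the normalized projection to $I^{\mathbb Z}$ of $\nu$ restricted to $I^{\mathbb Z}\times A_{r,k}$. For $k\ge0$ and an $\mathbb S^{2^k}$-invariant Borel probability measure $\eta$ on $I^{\mathbb Z}$, $D_k[\eta]=\sum_{i=0}^{2^k-1}\mathbb S^i\eta\times(\chi_{A_{i,k}}m)$. A measure $\nu\in\mathbb M$ is of periodic type if $\nu=D_k[\eta]$ for some $k\ge0$ and some $\mathbb S^{2^k}$-invariant $\eta$; otherwise it is aperiodic.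 *)

theory Defs
  imports "HOL-Probability.Probability"
begin

(* I^Z as int => bool with the product sigma algebra (= Borel for the product topology) *)
definition XZ :: "(int \<Rightarrow> bool) measure" where
  "XZ = PiM UNIV (\<lambda>_. count_space UNIV)"

(* I^N: sequences (alpha_1, alpha_2, ...) stored 0-indexed: a i = alpha_(i+1) *)
definition XN :: "(nat \<Rightarrow> bool) measure" where
  "XN = PiM UNIV (\<lambda>_. count_space UNIV)"

definition bern :: "(nat \<Rightarrow> bool) measure" where
  "bern = PiM UNIV (\<lambda>_. measure_pmf (bernoulli_pmf (1/2)))"

definition shiftS :: "(int \<Rightarrow> bool) \<Rightarrow> (int \<Rightarrow> bool)" where
  "shiftS x = (\<lambda>i. x (i + 1))"

(* odometer (adding 1 with carry); the all-ones sequence (a null set) goes to all zeros *)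
definition odo :: "(nat \<Rightarrow> bool) \<Rightarrow> (nat \<Rightarrow> bool)" where
  "odo a = (if \<exists>n. \<not> a n then
      (let n = (LEAST n. \<not> a n) in (\<lambda>i. if i < n then False else if i = n then True else a i))
    else (\<lambda>_. False))"

definition TSO :: "(int \<Rightarrow> bool) \<times> (nat \<Rightarrow> bool) \<Rightarrow> (int \<Rightarrow> bool) \<times> (nat \<Rightarrow> bool)" where
  "TSO = map_prod shiftS odo"

definition Ark :: "nat \<Rightarrow> nat \<Rightarrow> (nat \<Rightarrow> bool) set" where
  "Ark r k = {a. (\<Sum>i<k. (if a i then 1 else 0) * 2 ^ i) = r}"

definition MM :: "((int \<Rightarrow> bool) \<times> (nat \<Rightarrow> bool)) measure set" where
  "MM = {\<nu>. prob_space \<nu> \<and> sets \<nu> = sets (XZ \<Otimes>\<^sub>M XN) \<and> distr \<nu> (XZ \<Otimes>\<^sub>M XN) TSO = \<nu>}"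

definition ergodic_SO :: "((int \<Rightarrow> bool) \<times> (nat \<Rightarrow> bool)) measure \<Rightarrow> bool" where
  "ergodic_SO \<nu> \<longleftrightarrow> (\<forall>C \<in> sets \<nu>. TSO -` C \<inter> space \<nu> = C \<longrightarrow>
      emeasure \<nu> C = 0 \<or> emeasure \<nu> C = 1)"

definition Dk_emeasure :: "nat \<Rightarrow> (int \<Rightarrow> bool) measure \<Rightarrow> ((int \<Rightarrow> bool) \<times> (nat \<Rightarrow> bool)) set \<Rightarrow> ennreal" where
  "Dk_emeasure k \<eta> C = (\<Sum>i<2^k. emeasure (distr \<eta> XZ (shiftS ^^ i) \<Otimes>\<^sub>M density bern (indicator (Ark i k))) C)"

definition periodic_type :: "((int \<Rightarrow> bool) \<times> (nat \<Rightarrow> bool)) measure \<Rightarrow> bool" where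
  "periodic_type \<nu> \<longleftrightarrow> (\<exists>k \<eta>. prob_space \<eta> \<and> sets \<eta> = sets XZ \<and>
      distr \<eta> XZ (shiftS ^^ (2^k)) = \<eta> \<and>
      (\<forall>C \<in> sets (XZ \<Otimes>\<^sub>M XN). emeasure \<nu> C = Dk_emeasure k \<eta> C))"

definition aperiodic :: "((int \<Rightarrow> bool) \<times> (nat \<Rightarrow> bool)) measure \<Rightarrow> bool" where
  "aperiodic \<nu> \<longleftrightarrow> \<not> periodic_type \<nu>"

definition Proj :: "nat \<Rightarrow> nat \<Rightarrow> ((int \<Rightarrow> bool) \<times> (nat \<Rightarrow> bool)) measure \<Rightarrow> (int \<Rightarrow> bool) measure" where
  "Proj r k \<nu> = distr (density \<nu> (\<lambda>z. indicator (UNIV \<times> Ark r k) z / emeasure \<nu> (UNIV \<times> Ark r k))) XZ fst"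

definition mutually_singular :: "'a measure \<Rightarrow> 'a measure \<Rightarrow> bool" where
  "mutually_singular \<mu>1 \<mu>2 \<longleftrightarrow> (\<exists>C \<in> sets \<mu>1. emeasure \<mu>1 C = 0 \<and> emeasure \<mu>2 (space \<mu>2 - C) = 0)"

end

theory Submission
  imports Defs
begin

text \<open>
  Let \<open>P k r\<close> be the normalised projection to \<open>I^Z\<close> of the part of \<open>\<nu>\<close> over the residue class of
  \<open>r\<close> modulo \<open>2^k\<close>. The shift maps \<open>P k r\<close> to \<open>P k (r + 1)\<close>, and \<open>P k r\<close> is the average of
  \<open>P (k + 1) r\<close> and \<open>P (k + 1) (r + 2^k)\<close>. Ergodicity of \<open>\<nu>\<close> makes each \<open>P k r\<close> ergodic under the
  \<open>2^k\<close>-th power of the shift, so two of them are equal or mutually singular. If \<open>P k r1 = P k r2\<close>,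
  then \<open>P k\<close> has period \<open>r1 - r2\<close>, hence also period \<open>2^j = gcd (r1 - r2) (2^k)\<close>, where \<open>j < k\<close>. This
  period persists at all finer levels: if \<open>P l\<close> has period \<open>2^j\<close> with \<open>j < l\<close>, then
  \<open>P (l + 1) 0 \<le> 2 P l 0 = 2 P l (2^j) = P (l + 1) (2^j) + P (l + 1) (2^j + 2^l)\<close>, so \<open>P (l + 1) 0\<close>
  is not singular to both summands; it equals one of them, and either coincidence gives the period
  \<open>2^j\<close>. Hence \<open>P l = P j\<close> for all \<open>l \<ge> j\<close>, which says that \<open>\<nu>\<close> is \<open>D_j\<close> of \<open>P j 0\<close>.
\<close>

section \<open>Ergodic measures of a group action\<close>

locale measurable_action =
  fixes X :: "'a measure" and T :: "'g::group_add \<Rightarrow> 'a \<Rightarrow> 'a"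
  assumes measurable_action [measurable]: "T g \<in> measurable X X"
    and action_zero: "x \<in> space X \<Longrightarrow> T 0 x = x"
    and action_add: "x \<in> space X \<Longrightarrow> T (g + h) x = T g (T h x)"
begin

lemma action_in_space: "x \<in> space X \<Longrightarrow> T g x \<in> space X"
  using measurable_space[OF measurable_action] .

lemma vimage_action_vimage_action:
  "T g -` (T h -` D \<inter> space X) \<inter> space X = T (h + g) -` D \<inter> space X"
  by (auto simp: action_add action_in_space)

lemma vimage_action_zero:
  assumes "D \<in> sets X"
  shows "T 0 -` D \<inter> space X = D"
  using sets.sets_into_space[OF assms] by (auto simp: action_zero)

lemma vimage_action_UN_translates:
  "T h -` (\<Union>g. T g -` D \<inter> space X) \<inter> space X = (\<Union>g. T g -` D \<inter> space X)"
proof -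
  have "T h -` (\<Union>g. T g -` D \<inter> space X) \<inter> space X = (\<Union>g. T (g + h) -` D \<inter> space X)"
    by (auto simp: action_add action_in_space)
  also have "\<dots> = (\<Union>g \<in> range (\<lambda>g. g + h). T g -` D \<inter> space X)"
    by blast
  also have "range (\<lambda>g. g + h) = UNIV"
    using surjI[of "\<lambda>g. g + h" "\<lambda>g. g - h"] by simp
  finally show ?thesis .
qed

lemma distr_action_zero:
  assumes "sets P = sets X"
  shows "distr P X (T 0) = P"
  using assms sets_eq_imp_space_eq[OF assms]
  by (intro measure_eqI) (simp_all add: emeasure_distr vimage_action_zero)

lemma distr_action_add:
  assumes [measurable_cong]: "sets P = sets X"
  shows "distr (distr P X (T h)) X (T g) = distr P X (T (g + h))"
proof -
  have "distr (distr P X (T h)) X (T g) = distr P X (T g \<circ> T h)"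
    by (rule distr_distr) measurable
  also have "\<dots> = distr P X (T (g + h))"
    using sets_eq_imp_space_eq[OF assms] by (intro distr_cong) (auto simp: action_add)
  finally show ?thesis .
qed

end

locale invariant_prob = measurable_action X T + prob_space P
  for X :: "'a measure" and T :: "'g::group_add \<Rightarrow> 'a \<Rightarrow> 'a" and P :: "'a measure" +
  assumes sets_eq [simp, measurable_cong]: "sets P = sets X"
    and distr_action: "distr P X (T g) = P"
begin

lemma space_eq [simp]: "space P = space X"
  using sets_eq by (rule sets_eq_imp_space_eq)

lemma emeasure_vimage_action:
  assumes "D \<in> sets X"
  shows "emeasure P (T g -` D \<inter> space X) = emeasure P D"
proof -
  have "emeasure (distr P X (T g)) D = emeasure P (T g -` D \<inter> space X)"
    using assms by (simp add: emeasure_distr)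
  then show ?thesis
    by (simp add: distr_action)
qed

end

locale ergodic_prob = invariant_prob +
  assumes ergodic: "D \<in> sets X \<Longrightarrow> (\<And>g. T g -` D \<inter> space X = D) \<Longrightarrow> prob D = 0 \<or> prob D = 1"

lemma emeasure_le_on_UN:
  fixes C :: "'i::countable \<Rightarrow> 'a set"
  assumes sets: "sets Q = sets P" and C_sets: "\<And>i. C i \<in> sets P"
    and Q_le_P: "\<And>i A. A \<in> sets P \<Longrightarrow> A \<subseteq> C i \<Longrightarrow> emeasure Q A \<le> emeasure P A"
    and A_sets: "A \<in> sets P" and A_subset: "A \<subseteq> (\<Union>i. C i)"
  shows "emeasure Q A \<le> emeasure P A"
proof -
  define F where "F n = A \<inter> C (from_nat n)" for n
  have "range F \<subseteq> sets P"
    using A_sets C_sets by (auto simp: F_def)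
  then have F_sets: "disjointed F n \<in> sets P" for n
    using sets.range_disjointed_sets[of F P] by blast
  have "A = A \<inter> (\<Union>i. C i)"
    using A_subset by blast
  also have "\<dots> = (\<Union>i \<in> range (from_nat :: nat \<Rightarrow> 'i). A \<inter> C i)"
    by simp
  also have "\<dots> = (\<Union>n. F n)"
    unfolding F_def by blast
  finally have A_eq: "A = (\<Union>n. disjointed F n)"
    by (simp add: UN_disjointed_eq)
  have suminf: "emeasure M A = (\<Sum>n. emeasure M (disjointed F n))" if "sets M = sets P" for M
    unfolding A_eq using F_sets that
    by (intro suminf_emeasure[symmetric]) (auto simp: disjoint_family_disjointed)
  have "emeasure Q (disjointed F n) \<le> emeasure P (disjointed F n)" for n
    using disjointed_subset[of F n] by (intro Q_le_P[of _ "from_nat n"] F_sets) (auto simp: F_def)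
  then show ?thesis
    by (simp add: suminf sets suminf_le)
qed

lemma emeasure_le_on_translate:
  assumes "invariant_prob X T P" "invariant_prob X T Q" and Y_sets: "Y \<in> sets X"
    and Q_le_P: "\<And>A. A \<in> sets X \<Longrightarrow> A \<subseteq> Y \<Longrightarrow> emeasure Q A \<le> emeasure P A"
    and A_sets: "A \<in> sets X" and A_subset: "A \<subseteq> T g -` Y \<inter> space X"
  shows "emeasure Q A \<le> emeasure P A"
proof -
  interpret P: invariant_prob X T P by fact
  interpret Q: invariant_prob X T Q by fact
  have "T (- g) -` A \<inter> space X \<subseteq> T (- g) -` (T g -` Y \<inter> space X) \<inter> space X"
    using A_subset by blast
  also have "\<dots> = Y"
    by (simp only: P.vimage_action_vimage_action add.right_inverse P.vimage_action_zero[OF Y_sets])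
  finally have "emeasure Q (T (- g) -` A \<inter> space X) \<le> emeasure P (T (- g) -` A \<inter> space X)"
    using A_sets by (intro Q_le_P) measurable
  then show ?thesis
    using A_sets by (simp add: P.emeasure_vimage_action Q.emeasure_vimage_action)
qed

text \<open>All translates of a Hahn set for \<open>P - Q\<close> are positive, hence so is their union.\<close>

lemma invariant_Hahn_decomposition:
  fixes T :: "'g::{countable, group_add} \<Rightarrow> 'a \<Rightarrow> 'a"
  assumes P: "invariant_prob X T P" and Q: "invariant_prob X T Q"
  obtains D where "D \<in> sets X" "\<And>g. T g -` D \<inter> space X = D"
    "\<And>A. A \<in> sets X \<Longrightarrow> A \<subseteq> D \<Longrightarrow> emeasure Q A \<le> emeasure P A"
    "\<And>A. A \<in> sets X \<Longrightarrow> A \<inter> D = {} \<Longrightarrow> emeasure P A \<le> emeasure Q A"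
proof -
  interpret P: invariant_prob X T P by (rule P)
  interpret Q: invariant_prob X T Q by (rule Q)
  obtain Y where Y_sets: "Y \<in> sets X"
    and Q_le: "\<And>A. A \<in> sets X \<Longrightarrow> A \<subseteq> Y \<Longrightarrow> emeasure Q A \<le> emeasure P A"
    and P_le: "\<And>A. A \<in> sets X \<Longrightarrow> A \<inter> Y = {} \<Longrightarrow> emeasure P A \<le> emeasure Q A"
    using finite_unsigned_Hahn_decomposition[OF P.finite_measure_axioms Q.finite_measure_axioms]
    by auto
  define D where "D = (\<Union>g. T g -` Y \<inter> space X)"
  have translates: "T g -` Y \<inter> space X \<in> sets X" for g
    using Y_sets by measurable
  then have "D \<in> sets X"
    unfolding D_def by blast
  moreover have "T g -` D \<inter> space X = D" for g
    unfolding D_def by (rule P.vimage_action_UN_translates)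
  moreover have "emeasure Q A \<le> emeasure P A" if "A \<in> sets X" "A \<subseteq> D" for A
  proof (rule emeasure_le_on_UN[where C = "\<lambda>g. T g -` Y \<inter> space X"])
    show "A \<subseteq> (\<Union>g. T g -` Y \<inter> space X)"
      using that(2) by (simp only: D_def)
  qed (use that translates emeasure_le_on_translate[OF P Q Y_sets Q_le] in auto)
  moreover have "Y \<subseteq> D"
    using P.vimage_action_zero[OF Y_sets] by (auto simp: D_def)
  then have "emeasure P A \<le> emeasure Q A" if "A \<in> sets X" "A \<inter> D = {}" for A
    using that by (intro P_le) auto
  ultimately show thesis
    by (rule that)
qed

lemma prob_space_eqI_le_on:
  assumes "prob_space P" "prob_space Q" and sets: "sets P = sets Q"
    and D_sets: "D \<in> sets P" and D_full: "measure P D = 1"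
    and P_le_Q_on: "\<And>A. A \<in> sets P \<Longrightarrow> A \<subseteq> D \<Longrightarrow> emeasure P A \<le> emeasure Q A"
  shows "P = Q"
proof (rule measure_eqI)
  interpret P: prob_space P by fact
  interpret Q: prob_space Q by fact
  have P_le_Q: "measure P A \<le> measure Q A" if A: "A \<in> sets P" for A
  proof -
    have "AE x in P. x \<in> D"
      using D_sets D_full by (simp add: P.prob_eq_1)
    then have "measure P A = measure P (A \<inter> D)"
      using A D_sets by (intro P.finite_measure_eq_AE) auto
    also have "\<dots> \<le> measure Q (A \<inter> D)"
      using P_le_Q_on[of "A \<inter> D"] A D_sets
      by (simp add: P.emeasure_eq_measure Q.emeasure_eq_measure)
    also have "\<dots> \<le> measure Q A"
      using A sets by (intro Q.finite_measure_mono) auto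
    finally show ?thesis .
  qed
  fix A assume A: "A \<in> sets P"
  have "measure P (space P - A) \<le> measure Q (space Q - A)"
    using P_le_Q[OF sets.compl_sets[OF A]] by (simp only: sets_eq_imp_space_eq[OF sets])
  then show "emeasure P A = emeasure Q A"
    using P_le_Q[OF A] A sets P.prob_compl[of A] Q.prob_compl[of A]
    by (simp add: P.emeasure_eq_measure Q.emeasure_eq_measure)
qed (rule sets)

theorem ergodic_prob_eq_or_mutually_singular:
  fixes T :: "'g::{countable, group_add} \<Rightarrow> 'a \<Rightarrow> 'a"
  assumes "ergodic_prob X T P" "ergodic_prob X T Q"
  shows "P = Q \<or> mutually_singular P Q"
proof -
  interpret P: ergodic_prob X T P by fact
  interpret Q: ergodic_prob X T Q by fact
  obtain D where D_sets: "D \<in> sets X" and D_invariant: "\<And>g. T g -` D \<inter> space X = D"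
    and Q_le: "\<And>A. A \<in> sets X \<Longrightarrow> A \<subseteq> D \<Longrightarrow> emeasure Q A \<le> emeasure P A"
    and P_le: "\<And>A. A \<in> sets X \<Longrightarrow> A \<inter> D = {} \<Longrightarrow> emeasure P A \<le> emeasure Q A"
    using invariant_Hahn_decomposition[OF P.invariant_prob_axioms Q.invariant_prob_axioms] by metis
  have compl: "P.prob (space X - D) = 1 - P.prob D"
    using P.prob_compl[of D] D_sets by simp
  consider "P.prob D = 0" | "Q.prob D = 1" | "P.prob D = 1" "Q.prob D = 0"
    using P.ergodic[OF D_sets D_invariant] Q.ergodic[OF D_sets D_invariant] by blast
  then show ?thesis
  proof cases
    case 1
    then have "P = Q"
      using compl D_sets
      by (intro prob_space_eqI_le_on[of P Q "space X - D"] P.prob_space_axioms Q.prob_space_axioms)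
        (auto intro!: P_le)
    then show ?thesis ..
  next
    case 2
    then have "Q = P"
      using D_sets Q_le
      by (intro prob_space_eqI_le_on[of Q P D] P.prob_space_axioms Q.prob_space_axioms) auto
    then show ?thesis
      by simp
  next
    case 3
    then have "emeasure P (space X - D) = 0" "emeasure Q (space Q - (space X - D)) = 0"
      using compl sets.sets_into_space[OF D_sets]
      by (simp_all add: P.emeasure_eq_measure Q.emeasure_eq_measure double_diff)
    then have "mutually_singular P Q"
      unfolding mutually_singular_def using D_sets by (intro bexI[of _ "space X - D"]) auto
    then show ?thesis ..
  qed
qed

lemma mutually_singular_both_imp_null:
  assumes "mutually_singular P Q" "mutually_singular P R"
    and sets: "sets Q = sets P" "sets R = sets P"
    and abs_cont: "\<And>N. N \<in> null_sets Q \<Longrightarrow> N \<in> null_sets R \<Longrightarrow> N \<in> null_sets P"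
  shows "emeasure P (space P) = 0"
proof -
  have space: "space Q = space P" "space R = space P"
    using sets[THEN sets_eq_imp_space_eq] .
  obtain A B where A: "A \<in> null_sets P" and A_compl: "space P - A \<in> null_sets Q"
    and B: "B \<in> null_sets P" and B_compl: "space P - B \<in> null_sets R"
    using assms(1,2) sets space by (auto simp: mutually_singular_def null_sets_def)
  have "space P - (A \<union> B) \<in> sets P"
    using A B by auto
  then have "space P - (A \<union> B) \<in> null_sets Q" "space P - (A \<union> B) \<in> null_sets R"
    using null_sets_subset[OF A_compl] null_sets_subset[OF B_compl] sets by auto
  then have "(A \<union> B) \<union> (space P - (A \<union> B)) \<in> null_sets P"
    using A B abs_cont by blast
  moreover have "(A \<union> B) \<union> (space P - (A \<union> B)) = space P"
    using A B sets.sets_into_space by auto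
  ultimately show ?thesis
    by auto
qed

section \<open>The odometer and its cylinders\<close>

lemma space_XN [simp]: "space XN = UNIV"
  by (simp add: XN_def space_PiM)

lemma XN_component_measurable [measurable]: "(\<lambda>a. a i) \<in> measurable XN (count_space UNIV)"
  unfolding XN_def by (rule measurable_component_singleton) simp

text \<open>For \<open>0 \<le> r < 2 ^ k\<close> this is \<open>Ark r k\<close>. Only the residue of \<open>r\<close> modulo \<open>2 ^ k\<close> matters;
  letting \<open>r\<close> range over the integers avoids all bounds on residues.\<close>

definition cylinder :: "nat \<Rightarrow> int \<Rightarrow> (nat \<Rightarrow> bool) set" where
  "cylinder k r = {a. \<forall>i<k. a i = bit r i}"

lemma cylinder_sets [measurable]: "cylinder k r \<in> sets XN"
proof -
  have "{a \<in> space XN. \<forall>i<k. a i = bit r i} \<in> sets XN"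
    by measurable
  then show ?thesis
    by (simp add: cylinder_def)
qed

lemma mem_cylinder_iff_horner_sum:
  "a \<in> cylinder k r \<longleftrightarrow> horner_sum of_bool 2 (map a [0..<k]) = take_bit k r"
proof
  assume "a \<in> cylinder k r"
  then have "map a [0..<k] = map (bit r) [0..<k]"
    by (simp add: cylinder_def)
  then show "horner_sum of_bool 2 (map a [0..<k]) = take_bit k r"
    by (simp only: horner_sum_bit_eq_take_bit)
next
  assume horner_eq: "horner_sum of_bool 2 (map a [0..<k]) = take_bit k r"
  have "a i = bit r i" if "i < k" for i
    using arg_cong[OF horner_eq, of "\<lambda>x. bit x i"] that
    by (simp add: bit_horner_sum_bit_iff bit_take_bit_iff)
  then show "a \<in> cylinder k r"
    by (simp add: cylinder_def)
qed

lemma cylinder_cong: "take_bit k r = take_bit k s \<Longrightarrow> cylinder k r = cylinder k s"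
  by (auto simp: mem_cylinder_iff_horner_sum)

lemma cylinder_disjoint: "take_bit k r \<noteq> take_bit k s \<Longrightarrow> cylinder k r \<inter> cylinder k s = {}"
  by (auto simp: mem_cylinder_iff_horner_sum)

lemma cylinder_Int_finer:
  assumes "j \<le> l"
  shows "cylinder l s \<inter> cylinder j r = (if take_bit j s = take_bit j r then cylinder l s else {})"
proof -
  have "cylinder l s \<subseteq> cylinder j s"
    using assms by (auto simp: cylinder_def)
  then show ?thesis
    using cylinder_cong[of j s r] cylinder_disjoint[of j s r] by auto
qed

lemma take_bit_of_nat_less: "s < 2 ^ k \<Longrightarrow> take_bit k (int s) = int s"
  by (simp add: take_bit_eq_mod)

lemma disjoint_family_cylinder: "disjoint_family_on (\<lambda>s. cylinder k (int s)) {..<2 ^ k}"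
  unfolding disjoint_family_on_def
  by (intro ballI impI cylinder_disjoint) (simp add: take_bit_of_nat_less)

lemma Ark_eq_cylinder:
  assumes "r < 2 ^ k"
  shows "Ark r k = cylinder k (int r)"
proof -
  have horner: "horner_sum of_bool 2 (map a [0..<k]) =
      int (\<Sum>i<k. (if a i then 1 else 0) * 2 ^ i)" for a
    by (auto simp: horner_sum_eq_sum of_bool_def lessThan_atLeast0 intro!: sum.cong)
  show ?thesis
    by (intro set_eqI) (simp only: Ark_def mem_Collect_eq mem_cylinder_iff_horner_sum horner
        take_bit_of_nat_less[OF assms] of_nat_eq_iff)
qed

lemma UN_cylinder_subset:
  assumes "\<And>a b. a \<in> B \<Longrightarrow> \<forall>i<l. a i = b i \<Longrightarrow> b \<in> B"
  shows "(\<Union>s \<in> {s. s < 2 ^ l \<and> cylinder l (int s) \<subseteq> B}. cylinder l (int s)) = B"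
proof (intro equalityI subsetI)
  fix a assume a: "a \<in> B"
  define s :: nat where "s = horner_sum of_bool 2 (map a [0..<l])"
  have "a \<in> cylinder l (int s)"
    by (auto simp: cylinder_def s_def bit_simps)
  moreover from this have "cylinder l (int s) \<subseteq> B"
    using a assms by (auto simp: cylinder_def)
  moreover have "s < 2 ^ l"
    using horner_sum_of_bool_2_less[of "map a [0..<l]"] by (simp add: s_def)
  ultimately show "a \<in> (\<Union>s \<in> {s. s < 2 ^ l \<and> cylinder l (int s) \<subseteq> B}. cylinder l (int s))"
    by blast
qed blast

lemma UN_cylinder: "(\<Union>s<2 ^ k. cylinder k (int s)) = UNIV"
  using UN_cylinder_subset[of UNIV k] by (auto simp: lessThan_def)

lemma bit_add_power_int: "bit (r + 2 ^ k) k \<longleftrightarrow> \<not> bit r k" for r :: int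
  by (simp add: bit_iff_odd)

lemma cylinder_Suc: "cylinder k r = cylinder (Suc k) r \<union> cylinder (Suc k) (r + 2 ^ k)"
proof -
  have "bit (r + 2 ^ k) i = bit r i" if "i < k" for i
  proof -
    have "take_bit k (r + 2 ^ k) = take_bit k r"
      by (simp add: take_bit_eq_mod)
    then show ?thesis
      using that by (metis bit_take_bit_iff)
  qed
  then show ?thesis
    by (auto simp: cylinder_def less_Suc_eq bit_add_power_int)
qed

lemma cylinder_Suc_disjoint: "cylinder (Suc k) r \<inter> cylinder (Suc k) (r + 2 ^ k) = {}"
  by (auto simp: cylinder_def bit_add_power_int)

lemma odo_apply: "odo a i \<longleftrightarrow> a i \<noteq> (\<forall>m<i. a m)"
proof (cases "\<exists>n. \<not> a n")
  case True
  define n where "n = (LEAST n. \<not> a n)"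
  have n_least: "\<not> a n" "m < n \<Longrightarrow> a m" for m
    unfolding n_def using LeastI_ex[OF True] not_less_Least by blast+
  have "(\<forall>m<i. a m) \<longleftrightarrow> i \<le> n"
    using n_least by (meson leI less_le_trans)
  moreover have "odo a i = (if i < n then False else if i = n then True else a i)"
    using True by (simp add: odo_def n_def Let_def)
  ultimately show ?thesis
    using n_least by auto
qed (auto simp: odo_def)

lemma bit_add_one_int: "bit (r + 1) i \<longleftrightarrow> bit r i \<noteq> (\<forall>m<i. bit r m)" for r :: int
proof (induction i arbitrary: r)
  case (Suc i)
  have "(r + 1) div 2 = (if even r then r div 2 else r div 2 + 1)"
    by auto
  then show ?case
    using Suc.IH[of "r div 2"] by (auto simp: bit_Suc bit_0 All_less_Suc2)
qed (simp add: bit_0)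

lemma vimage_odo_cylinder: "odo -` cylinder k (r + 1) = cylinder k r"
proof -
  have "(\<forall>i<k. odo a i = bit (r + 1) i) \<longleftrightarrow> (\<forall>i<k. a i = bit r i)" for a
  proof
    assume odo: "\<forall>i<k. odo a i = bit (r + 1) i"
    have "i < k \<Longrightarrow> a i = bit r i" for i
    proof (induction i rule: less_induct)
      case (less i)
      then show ?case
        using odo by (auto simp: odo_apply bit_add_one_int)
    qed
    then show "\<forall>i<k. a i = bit r i"
      by blast
  qed (auto simp: odo_apply bit_add_one_int)
  then show ?thesis
    by (auto simp: cylinder_def)
qed

lemma odo_measurable [measurable]: "odo \<in> measurable XN XN"
proof -
  have "(\<lambda>a. odo a i) \<in> measurable XN (count_space UNIV)" for i
    unfolding odo_apply by measurable
  then show ?thesis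
    by (subst XN_def, intro measurable_PiM_single') (auto simp: space_PiM)
qed

lemma measure_eqI_cylinder:
  assumes sets: "sets M = sets XN" "sets N = sets XN" and "finite_measure M"
    and emeasure_eq: "\<And>l r. j \<le> l \<Longrightarrow> emeasure M (cylinder l r) = emeasure N (cylinder l r)"
  shows "M = N"
proof (rule measure_eqI_PiM_infinite)
  show "sets M = PiM UNIV (\<lambda>_. count_space UNIV)" "sets N = PiM UNIV (\<lambda>_. count_space UNIV)"
    using sets by (simp_all add: XN_def)
  fix A :: "nat \<Rightarrow> bool set" and J :: "nat set"
  assume "finite J"
  then obtain n where J_less: "\<And>i. i \<in> J \<Longrightarrow> i < n"
    by (auto simp: finite_nat_set_iff_bounded)
  define l where "l = max j n"
  define B where "B = prod_emb UNIV (\<lambda>_. count_space UNIV) J (Pi\<^sub>E J A)"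
  define S where "S = {s. s < 2 ^ l \<and> cylinder l (int s) \<subseteq> B}"
  have "b \<in> B" if "a \<in> B" "\<forall>i<l. a i = b i" for a b
  proof -
    have "a i = b i" if "i \<in> J" for i
      using J_less[OF that] \<open>\<forall>i<l. a i = b i\<close> by (simp add: l_def less_max_iff_disj)
    then show ?thesis
      using \<open>a \<in> B\<close> by (auto simp: B_def prod_emb_iff PiE_iff)
  qed
  then have B_eq: "B = (\<Union>s\<in>S. cylinder l (int s))"
    unfolding S_def by (intro UN_cylinder_subset[symmetric])
  have disjoint: "disjoint_family_on (\<lambda>s. cylinder l (int s)) S"
    by (rule disjoint_family_on_mono[OF _ disjoint_family_cylinder]) (auto simp: S_def)
  have "emeasure K B = (\<Sum>s\<in>S. emeasure K (cylinder l (int s)))" if "sets K = sets XN" for K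
    unfolding B_eq using disjoint that by (intro sum_emeasure[symmetric]) (auto simp: S_def)
  then show "emeasure M (prod_emb UNIV (\<lambda>_. count_space UNIV) J (Pi\<^sub>E J A)) =
      emeasure N (prod_emb UNIV (\<lambda>_. count_space UNIV) J (Pi\<^sub>E J A))"
    using sets by (simp add: emeasure_eq l_def flip: B_def)
qed fact

lemma sets_bern [simp, measurable_cong]: "sets bern = sets XN"
  unfolding bern_def XN_def by (rule sets_PiM_cong) auto

lemma prob_space_bern: "prob_space bern"
  unfolding bern_def by (intro prob_space_PiM measure_pmf.prob_space_axioms)

lemma emeasure_bern_cylinder: "emeasure bern (cylinder k r) = ennreal ((1/2) ^ k)"
proof -
  define p where "p = measure_pmf (bernoulli_pmf (1/2))"
  have box: "cylinder k r = prod_emb UNIV (\<lambda>_. p) {..<k} (\<Pi>\<^sub>E i\<in>{..<k}. {bit r i})"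
    by (auto simp: cylinder_def prod_emb_iff PiE_iff p_def)
  have coin: "emeasure p {b} = ennreal (1/2)" for b
    by (cases b) (auto simp: p_def emeasure_pmf_single)
  have "emeasure bern (cylinder k r) = (\<Prod>i<k. emeasure p {bit r i})"
    unfolding bern_def box unfolding p_def
    by (rule emeasure_PiM_emb) (auto intro: measure_pmf.prob_space_axioms)
  also have "\<dots> = ennreal (1/2) ^ k"
    by (simp only: coin prod_constant card_lessThan)
  finally show ?thesis
    by (simp only: ennreal_power)
qed

section \<open>Integer periods\<close>

lemma periodic_fun_simple_gcd:
  fixes f :: "int \<Rightarrow> 'b"
  assumes "periodic_fun_simple f d" "periodic_fun_simple f e"
  shows "periodic_fun_simple f (gcd d e)"
proof
  interpret d: periodic_fun_simple f d by fact
  interpret e: periodic_fun_simple f e by fact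
  fix x
  obtain u v where "u * d + v * e = gcd d e"
    using bezout_int by blast
  then have "f (x + gcd d e) = f (x + u * d + v * e)"
    by (simp add: add.assoc)
  also have "\<dots> = f x"
    using d.plus_of_int[of x u] e.plus_of_int[of "x + u * d" v] by simp
  finally show "f (x + gcd d e) = f x" .
qed

lemma vimage_action_cong_mod:
  fixes T :: "int \<Rightarrow> 'a \<Rightarrow> 'a"
  assumes "measurable_action X T"
    and invariant: "\<And>q. T (q * m) -` D \<inter> space X = D" and "m dvd i - j"
  shows "T i -` D \<inter> space X = T j -` D \<inter> space X"
proof -
  interpret measurable_action X T by fact
  obtain q where "i = q * m + j"
    using \<open>m dvd i - j\<close> by (metis dvdE diff_add_cancel mult.commute)
  then have "T i -` D \<inter> space X = T j -` (T (q * m) -` D \<inter> space X) \<inter> space X"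
    by (simp only: vimage_action_vimage_action)
  then show ?thesis
    by (simp only: invariant)
qed

lemma gcd_sum_power2:
  assumes "j < l"
  shows "gcd (2 ^ j + 2 ^ l) (2 ^ Suc l) = (2 ^ j :: int)"
proof -
  obtain m where l_eq: "l = j + Suc m"
    using assms less_iff_Suc_add by auto
  have "gcd (2 ^ j + 2 ^ l) (2 ^ Suc l) =
      gcd (2 ^ j * (1 + 2 ^ Suc m)) (2 ^ j * 2 ^ (m + 2) :: int)"
    by (simp add: l_eq power_add algebra_simps)
  also have "\<dots> = 2 ^ j * gcd (1 + 2 ^ Suc m) (2 ^ (m + 2))"
    by (simp only: gcd_mult_distrib_int[symmetric]) simp
  also have "coprime (1 + 2 ^ Suc m :: int) (2 ^ (m + 2))"
    by (intro coprime_power_right_iff[THEN iffD2]) simp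
  then have "gcd (1 + 2 ^ Suc m :: int) (2 ^ (m + 2)) = 1"
    by (simp only: coprime_iff_gcd_eq_1)
  finally show ?thesis
    by simp
qed

section \<open>Invariant measures over the odometer\<close>

locale odometer_extension = measurable_action X T + prob_space \<nu>
  for X :: "'a measure" and T :: "int \<Rightarrow> 'a \<Rightarrow> 'a" and \<nu> :: "('a \<times> (nat \<Rightarrow> bool)) measure" +
  assumes sets_nu [simp, measurable_cong]: "sets \<nu> = sets (X \<Otimes>\<^sub>M XN)"
    and distr_nu: "distr \<nu> (X \<Otimes>\<^sub>M XN) (map_prod (T 1) odo) = \<nu>"
begin

lemma space_nu [simp]: "space \<nu> = space X \<times> UNIV"
  using sets_eq_imp_space_eq[OF sets_nu] by (simp add: space_pair_measure)

lemma prob_vimage_Times: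
  assumes [measurable]: "A \<in> sets X" "B \<in> sets XN"
  shows "prob ((T 1 -` A \<inter> space X) \<times> odo -` B) = prob (A \<times> B)"
proof -
  have "prob (A \<times> B) = measure (distr \<nu> (X \<Otimes>\<^sub>M XN) (map_prod (T 1) odo)) (A \<times> B)"
    by (simp only: distr_nu)
  also have "\<dots> = prob (map_prod (T 1) odo -` (A \<times> B) \<inter> space \<nu>)"
    by (rule measure_distr) (auto simp: map_prod_def)
  also have "map_prod (T 1) odo -` (A \<times> B) \<inter> space \<nu> = (T 1 -` A \<inter> space X) \<times> odo -` B"
    by auto
  finally show ?thesis ..
qed

lemma prob_vimage_Times_cylinder:
  assumes "A \<in> sets X"
  shows "prob ((T 1 -` A \<inter> space X) \<times> cylinder k r) = prob (A \<times> cylinder k (r + 1))"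
  using prob_vimage_Times[OF assms cylinder_sets, of k "r + 1"] by (simp add: vimage_odo_cylinder)

lemma prob_Times_cylinder_Suc:
  assumes "A \<in> sets X"
  shows "prob (A \<times> cylinder k r) =
    prob (A \<times> cylinder (Suc k) r) + prob (A \<times> cylinder (Suc k) (r + 2 ^ k))"
  unfolding cylinder_Suc[of k r] Sigma_Un_distrib2
  using assms cylinder_Suc_disjoint by (intro finite_measure_Union) auto

lemma prob_eq_sum_cylinders:
  assumes "C \<in> sets \<nu>"
  shows "prob C = (\<Sum>s<2 ^ k. prob (C \<inter> (space X \<times> cylinder k (int s))))"
proof -
  have "C \<subseteq> space X \<times> UNIV"
    using sets.sets_into_space[OF assms] by simp
  also have "\<dots> = (\<Union>s<2 ^ k. space X \<times> cylinder k (int s))"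
    unfolding UN_cylinder[of k, symmetric] by blast
  finally have "C = (\<Union>s<2 ^ k. C \<inter> (space X \<times> cylinder k (int s)))"
    by blast
  then have "prob C = prob (\<Union>s<2 ^ k. C \<inter> (space X \<times> cylinder k (int s)))"
    by (rule arg_cong)
  also have "\<dots> = (\<Sum>s<2 ^ k. prob (C \<inter> (space X \<times> cylinder k (int s))))"
  proof (rule finite_measure_finite_Union)
    show "disjoint_family_on (\<lambda>s. C \<inter> (space X \<times> cylinder k (int s))) {..<2 ^ k}"
      using disjoint_family_cylinder[of k] unfolding disjoint_family_on_def by blast
  qed (use assms in auto)
  finally show ?thesis .
qed

lemma prob_space_Times_cylinder: "prob (space X \<times> cylinder k r) = (1/2) ^ k"
proof (induction k arbitrary: r)
  case 0
  have "cylinder 0 r = UNIV"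
    by (simp add: cylinder_def)
  then show ?case
    using prob_space by simp
next
  case (Suc k)
  interpret periodic_fun_simple' "\<lambda>r. prob (space X \<times> cylinder (Suc k) r)"
  proof
    fix s
    have "T 1 -` space X \<inter> space X = space X"
      by (auto intro: action_in_space)
    then show "prob (space X \<times> cylinder (Suc k) (s + 1)) = prob (space X \<times> cylinder (Suc k) s)"
      using prob_vimage_Times_cylinder[of "space X" "Suc k" s] by simp
  qed
  show ?case
    using Suc.IH[of r] prob_Times_cylinder_Suc[of "space X" k r] plus_of_int[of r "2 ^ k"] by simp
qed

definition slice :: "nat \<Rightarrow> int \<Rightarrow> 'a measure" where
  "slice k r = distr (uniform_measure \<nu> (space X \<times> cylinder k r)) X fst"

lemma sets_slice [simp, measurable_cong]: "sets (slice k r) = sets X"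
  and space_slice [simp]: "space (slice k r) = space X"
  by (simp_all add: slice_def)

lemma emeasure_Times_cylinder_neq_0: "emeasure \<nu> (space X \<times> cylinder k r) \<noteq> 0"
  by (simp add: emeasure_eq_measure prob_space_Times_cylinder)

lemma prob_space_slice: "prob_space (slice k r)"
  unfolding slice_def
  by (intro prob_space.prob_space_distr prob_space_uniform_measure emeasure_Times_cylinder_neq_0)
    auto

lemma measure_slice:
  assumes [measurable]: "A \<in> sets X"
  shows "measure (slice k r) A = 2 ^ k * prob (A \<times> cylinder k r)"
proof -
  have vimage_fst: "fst -` A \<inter> space X \<times> UNIV = A \<times> UNIV"
    using sets.sets_into_space[OF assms] by auto
  have "measure (slice k r) A = measure (uniform_measure \<nu> (space X \<times> cylinder k r)) (A \<times> UNIV)"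
    unfolding slice_def by (subst measure_distr) (auto simp: vimage_fst)
  also have "\<dots> = prob ((space X \<times> cylinder k r) \<inter> (A \<times> UNIV)) / prob (space X \<times> cylinder k r)"
    using sets.top[of XN] by (intro measure_uniform_measure emeasure_Times_cylinder_neq_0) auto
  also have "(space X \<times> cylinder k r) \<inter> (A \<times> UNIV) = A \<times> cylinder k r"
    using sets.sets_into_space[OF assms] by auto
  finally show ?thesis
    by (simp add: prob_space_Times_cylinder power_divide mult.commute)
qed

lemma emeasure_slice: "emeasure (slice k r) A = ennreal (measure (slice k r) A)"
  using prob_space_slice by (intro finite_measure.emeasure_eq_measure prob_space.finite_measure)

lemma slice_eqI:
  assumes "\<And>A. A \<in> sets X \<Longrightarrow> measure (slice k r) A = measure (slice l s) A"
  shows "slice k r = slice l s"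
  using assms by (intro measure_eqI) (auto simp: emeasure_slice)

lemma slice_cong: "take_bit k r = take_bit k s \<Longrightarrow> slice k r = slice k s"
  unfolding slice_def by (drule cylinder_cong) simp

lemma slice_period_power2: "periodic_fun_simple (slice k) (2 ^ k)"
  by standard (rule slice_cong, simp add: take_bit_eq_mod)

lemma measure_slice_Suc:
  assumes "A \<in> sets X"
  shows "2 * measure (slice k r) A =
    measure (slice (Suc k) r) A + measure (slice (Suc k) (r + 2 ^ k)) A"
  using assms by (simp add: measure_slice prob_Times_cylinder_Suc[of A k] algebra_simps)

lemma distr_slice_one: "distr (slice k r) X (T 1) = slice k (r + 1)"
  by (rule measure_eqI)
     (auto simp: emeasure_distr emeasure_slice measure_slice prob_vimage_Times_cylinder)

lemma distr_slice: "distr (slice k r) X (T j) = slice k (r + j)"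
proof (induction j rule: int_induct[where k = 0])
  case base
  show ?case
    by (simp add: distr_action_zero)
next
  case (step1 j)
  have "distr (slice k r) X (T (j + 1)) = distr (distr (slice k r) X (T j)) X (T 1)"
    by (simp add: distr_action_add add.commute)
  then show ?case
    using step1 distr_slice_one[of k "r + j"] by (simp add: add.assoc)
next
  case (step2 j)
  have "distr (slice k r) X (T (j - 1)) = distr (distr (slice k r) X (T j)) X (T (- 1))"
    by (simp add: distr_action_add)
  also have "\<dots> = distr (distr (slice k (r + j - 1)) X (T 1)) X (T (- 1))"
    using step2 distr_slice_one[of k "r + j - 1"] by simp
  also have "\<dots> = slice k (r + j - 1)"
    by (simp add: distr_action_add distr_action_zero)
  finally show ?case
    by (simp add: add_diff_eq)
qed

lemma prob_translate_Times_cylinder: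
  assumes D_sets: "D \<in> sets X"
  shows "prob ((T (r - s) -` D \<inter> space X) \<times> cylinder k s) = measure (slice k r) D / 2 ^ k"
proof -
  have "measure (slice k r) D = measure (distr (slice k s) X (T (r - s))) D"
    by (simp add: distr_slice)
  also have "\<dots> = measure (slice k s) (T (r - s) -` D \<inter> space X)"
    using D_sets by (simp add: measure_distr)
  also have "\<dots> = 2 ^ k * prob ((T (r - s) -` D \<inter> space X) \<times> cylinder k s)"
    using D_sets by (intro measure_slice) measurable
  finally show ?thesis
    by simp
qed

lemma slice_periodI:
  assumes "slice k (r + d) = slice k r"
  shows "periodic_fun_simple (slice k) d"
proof
  fix x
  have "slice k (x + d) = distr (slice k (r + d)) X (T (x - r))"
    by (simp add: distr_slice add.commute)
  also have "\<dots> = slice k x"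
    by (simp add: assms distr_slice)
  finally show "slice k (x + d) = slice k x" .
qed

lemma slice_period_coarser:
  assumes "periodic_fun_simple (slice (Suc k)) d"
  shows "periodic_fun_simple (slice k) d"
proof (rule slice_periodI[of _ 0], rule slice_eqI)
  interpret periodic_fun_simple "slice (Suc k)" d by fact
  fix A assume "A \<in> sets X"
  then show "measure (slice k (0 + d)) A = measure (slice k 0) A"
    using measure_slice_Suc[of A k d] measure_slice_Suc[of A k 0]
      plus_period[of 0] plus_period[of "2 ^ k"]
    by (simp add: add.commute)
qed

definition stable_from :: "nat \<Rightarrow> bool" where
  "stable_from j \<longleftrightarrow> (\<forall>l\<ge>j. \<forall>t. slice l t = slice j t)"

lemma stable_from_if_periodic:
  assumes "\<And>l. j \<le> l \<Longrightarrow> periodic_fun_simple (slice l) (2 ^ j)"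
  shows "stable_from j"
proof -
  have "slice l r = slice j r" if "j \<le> l" for l r
    using that
  proof (induction rule: dec_induct)
    case (step l)
    interpret periodic_fun_simple "slice (Suc l)" "2 ^ j"
      using assms step by simp
    have "(2::int) ^ l = 2 ^ (l - j) * 2 ^ j"
      using step by (simp flip: power_add)
    then have "slice (Suc l) (r + 2 ^ l) = slice (Suc l) r"
      using plus_of_int[of r "2 ^ (l - j)"] by simp
    then have "slice (Suc l) r = slice l r"
      using measure_slice_Suc[of _ l r] by (intro slice_eqI) simp
    then show ?case
      using step by simp
  qed simp
  then show ?thesis
    unfolding stable_from_def by blast
qed

lemma emeasure_distr_restricted_snd:
  assumes A: "A \<in> sets X" and [measurable]: "B \<in> sets XN" "C \<in> sets XN"
  shows "emeasure (distr (density \<nu> (indicator (A \<times> C))) XN snd) B = emeasure \<nu> (A \<times> (B \<inter> C))"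
proof -
  have vimage_snd: "snd -` B \<inter> space X \<times> UNIV = space X \<times> B"
    by auto
  have "emeasure (distr (density \<nu> (indicator (A \<times> C))) XN snd) B =
      emeasure \<nu> ((A \<times> C) \<inter> (space X \<times> B))"
    using A by (subst emeasure_distr) (auto simp: vimage_snd emeasure_restricted)
  also have "(A \<times> C) \<inter> (space X \<times> B) = A \<times> (B \<inter> C)"
    using sets.sets_into_space[OF A] by auto
  finally show ?thesis .
qed

lemma emeasure_Times_stable:
  assumes stable: "stable_from j" and A: "A \<in> sets X" and B: "B \<in> sets XN"
  shows "emeasure \<nu> (A \<times> (B \<inter> cylinder j r)) =
    emeasure (slice j r) A * emeasure bern (B \<inter> cylinder j r)"
proof -
  define M where "M = distr (density \<nu> (indicator (A \<times> cylinder j r))) XN snd"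
  define N where
    "N = scale_measure (emeasure (slice j r) A) (density bern (indicator (cylinder j r)))"
  have emeasure_M: "emeasure M C = emeasure \<nu> (A \<times> (C \<inter> cylinder j r))" if "C \<in> sets XN" for C
    unfolding M_def using A that by (intro emeasure_distr_restricted_snd) auto
  have emeasure_N: "emeasure N C = emeasure (slice j r) A * emeasure bern (C \<inter> cylinder j r)"
    if "C \<in> sets XN" for C
    using that by (simp add: N_def emeasure_restricted Int_commute)
  have "M = N"
  proof (rule measure_eqI_cylinder)
    show "finite_measure M"
      by (rule finite_measureI) (use emeasure_M[OF sets.top] in \<open>simp add: M_def\<close>)
    fix l s assume "j \<le> l"
    show "emeasure M (cylinder l s) = emeasure N (cylinder l s)"
    proof (cases "take_bit j s = take_bit j r")
      case True
      then have "slice j r = slice j s"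
        by (intro slice_cong) simp
      also have "\<dots> = slice l s"
        using stable \<open>j \<le> l\<close> unfolding stable_from_def by metis
      finally have "slice j r = slice l s" .
      then show ?thesis
        using True A \<open>j \<le> l\<close>
        by (simp add: emeasure_M emeasure_N cylinder_Int_finer emeasure_slice measure_slice
            emeasure_bern_cylinder emeasure_eq_measure power_divide flip: ennreal_mult)
    qed (simp add: emeasure_M emeasure_N cylinder_Int_finer \<open>j \<le> l\<close>)
  qed (simp_all add: M_def N_def)
  then show ?thesis
    using emeasure_M[OF B] emeasure_N[OF B] by simp
qed

lemma pair_measure_stable:
  assumes stable: "stable_from j"
  shows "slice j r \<Otimes>\<^sub>M density bern (indicator (cylinder j r)) =
    density \<nu> (indicator (space X \<times> cylinder j r))"
proof (rule pair_measure_eqI)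
  interpret slice: prob_space "slice j r"
    by (rule prob_space_slice)
  show "sigma_finite_measure (slice j r)"
    by unfold_locales
  interpret bern: prob_space bern
    by (rule prob_space_bern)
  have "finite_measure (density bern (indicator (cylinder j r)))"
    by (rule finite_measureI) (use sets.top[of bern] in \<open>simp add: emeasure_restricted\<close>)
  then show "sigma_finite_measure (density bern (indicator (cylinder j r)))"
    by (simp add: finite_measure_def)
  show "sets (slice j r \<Otimes>\<^sub>M density bern (indicator (cylinder j r))) =
      sets (density \<nu> (indicator (space X \<times> cylinder j r)))"
    by (simp cong: sets_pair_measure_cong)
  fix A B assume "A \<in> sets (slice j r)" "B \<in> sets (density bern (indicator (cylinder j r)))"
  then have A: "A \<in> sets X" and B: "B \<in> sets XN"
    by simp_all
  have "(space X \<times> cylinder j r) \<inter> (A \<times> B) = A \<times> (B \<inter> cylinder j r)"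
    using sets.sets_into_space[OF A] by auto
  then show "emeasure (slice j r) A * emeasure (density bern (indicator (cylinder j r))) B =
      emeasure (density \<nu> (indicator (space X \<times> cylinder j r))) (A \<times> B)"
    using A B emeasure_Times_stable[OF stable A B, of r]
    by (simp add: emeasure_restricted Int_commute)
qed

lemma emeasure_eq_sum_pair_measures:
  assumes stable: "stable_from j" and C_sets: "C \<in> sets \<nu>"
  shows "emeasure \<nu> C =
    (\<Sum>i<2 ^ j. emeasure (slice j (int i) \<Otimes>\<^sub>M density bern (indicator (cylinder j (int i)))) C)"
  using C_sets by (simp add: pair_measure_stable[OF stable] emeasure_restricted emeasure_eq_measure
      prob_eq_sum_cylinders[OF C_sets, of j] Int_commute)

end

section \<open>Ergodic measures over the odometer\<close>

locale ergodic_odometer_extension = odometer_extension +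
  assumes ergodic: "C \<in> sets \<nu> \<Longrightarrow> map_prod (T 1) odo -` C \<inter> space \<nu> = C \<Longrightarrow> prob C = 0 \<or> prob C = 1"
begin

text \<open>The sets \<open>E s \<times> cylinder k s\<close> form a tower that \<open>map_prod (T 1) odo\<close> climbs cyclically,
  so ergodicity applies to their union.\<close>

lemma prob_tower_0_or_1:
  fixes E :: "int \<Rightarrow> 'a set"
  assumes E_sets: "\<And>s. E s \<in> sets X" and vimage_E: "\<And>s. T 1 -` E (s + 1) \<inter> space X = E s"
    and E_cong: "\<And>s t. take_bit k s = take_bit k t \<Longrightarrow> E s = E t"
  shows "(\<Sum>s<2 ^ k. prob (E (int s) \<times> cylinder k (int s))) \<in> {0, 1}"
proof -
  define C where "C = (\<Union>s. E s \<times> cylinder k s)"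
  have C_sets: "C \<in> sets \<nu>"
    unfolding C_def using E_sets by (intro sets.countable_UN) auto
  have "map_prod (T 1) odo -` C \<inter> space \<nu> =
      (\<Union>s. (T 1 -` E s \<inter> space X) \<times> odo -` cylinder k s)"
    by (auto simp: C_def)
  also have "\<dots> = (\<Union>s \<in> range (\<lambda>s. s + 1). (T 1 -` E s \<inter> space X) \<times> odo -` cylinder k s)"
    using surjI[of "\<lambda>s::int. s + 1" "\<lambda>s. s - 1"] by simp
  also have "\<dots> = C"
    by (simp only: image_image C_def vimage_E vimage_odo_cylinder)
  finally have "prob C = 0 \<or> prob C = 1"
    by (rule ergodic[OF C_sets])
  moreover have "C \<inter> (space X \<times> cylinder k s) = E s \<times> cylinder k s" for s
  proof -
    have "E t \<times> (cylinder k t \<inter> cylinder k s) \<subseteq> E s \<times> cylinder k s" for t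
      using cylinder_disjoint[of k t s] E_cong[of t s] by blast
    then show ?thesis
      using sets.sets_into_space[OF E_sets] by (fastforce simp: C_def)
  qed
  ultimately show ?thesis
    using prob_eq_sum_cylinders[OF C_sets, of k] by simp
qed

lemma ergodic_prob_slice: "ergodic_prob X (\<lambda>j. T (j * 2 ^ k)) (slice k r)"
proof -
  interpret slice: prob_space "slice k r"
    by (rule prob_space_slice)
  interpret periodic_fun_simple "slice k" "2 ^ k"
    by (rule slice_period_power2)
  show ?thesis
  proof
    show "distr (slice k r) X (T (j * 2 ^ k)) = slice k r" for j
      using plus_of_int[of r j] by (simp add: distr_slice)
    fix D assume D_sets: "D \<in> sets X" and invariant: "\<And>j. T (j * 2 ^ k) -` D \<inter> space X = D"
    define E where "E s = T (r - s) -` D \<inter> space X" for s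
    have "(\<Sum>s<2 ^ k. prob (E (int s) \<times> cylinder k (int s))) \<in> {0, 1}"
    proof (rule prob_tower_0_or_1)
      show "E s \<in> sets X" for s
        unfolding E_def using D_sets by measurable
      show "T 1 -` E (s + 1) \<inter> space X = E s" for s
        unfolding E_def by (simp only: vimage_action_vimage_action) (simp add: algebra_simps)
      show "E s = E t" if "take_bit k s = take_bit k t" for s t
        unfolding E_def using that
        by (intro vimage_action_cong_mod[OF measurable_action_axioms invariant])
          (simp add: take_bit_eq_mod mod_eq_dvd_iff dvd_diff_commute)
    qed
    then show "slice.prob D = 0 \<or> slice.prob D = 1"
      using prob_translate_Times_cylinder[OF D_sets, of r _ k] by (simp add: E_def)
  qed (auto simp: action_zero action_add distrib_right)
qed

lemma slices_eq_or_mutually_singular: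
  "slice k r = slice k s \<or> mutually_singular (slice k r) (slice k s)"
  using ergodic_prob_slice ergodic_prob_slice by (rule ergodic_prob_eq_or_mutually_singular)

lemma slice_eq_refine:
  assumes slice_eq: "slice l r = slice l s"
  shows "slice (Suc l) r = slice (Suc l) s \<or> slice (Suc l) r = slice (Suc l) (s + 2 ^ l)"
proof (rule ccontr)
  assume "\<not> ?thesis"
  then have "mutually_singular (slice (Suc l) r) (slice (Suc l) s)"
    "mutually_singular (slice (Suc l) r) (slice (Suc l) (s + 2 ^ l))"
    using slices_eq_or_mutually_singular by blast+
  then have "emeasure (slice (Suc l) r) (space (slice (Suc l) r)) = 0"
  proof (rule mutually_singular_both_imp_null)
    fix N
    assume null: "N \<in> null_sets (slice (Suc l) s)" "N \<in> null_sets (slice (Suc l) (s + 2 ^ l))"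
    then have N_sets: "N \<in> sets X"
      by auto
    have "measure (slice (Suc l) r) N + measure (slice (Suc l) (r + 2 ^ l)) N =
        2 * measure (slice l s) N"
      using measure_slice_Suc[OF N_sets, of l r] slice_eq by simp
    also have "\<dots> = 0"
      unfolding measure_slice_Suc[OF N_sets] using null by (simp add: measure_eq_0_null_sets)
    finally have "measure (slice (Suc l) r) N + measure (slice (Suc l) (r + 2 ^ l)) N = 0" .
    then have "measure (slice (Suc l) r) N = 0"
      by (simp add: add_nonneg_eq_0_iff)
    then show "N \<in> null_sets (slice (Suc l) r)"
      using N_sets by (auto simp: emeasure_slice)
  qed simp_all
  then show False
    using prob_space.emeasure_space_1[OF prob_space_slice] by simp
qed

lemma slice_period_refine:
  assumes "j < l" "periodic_fun_simple (slice l) (2 ^ j)"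
  shows "periodic_fun_simple (slice (Suc l)) (2 ^ j)"
proof -
  interpret periodic_fun_simple "slice l" "2 ^ j" by fact
  consider "slice (Suc l) 0 = slice (Suc l) (2 ^ j)"
    | "slice (Suc l) 0 = slice (Suc l) (2 ^ j + 2 ^ l)"
    using slice_eq_refine[of l 0 "2 ^ j"] plus_period[of 0] by auto
  then show ?thesis
  proof cases
    case 1
    then show ?thesis
      by (intro slice_periodI[of _ 0]) simp
  next
    case 2
    then have "periodic_fun_simple (slice (Suc l)) (2 ^ j + 2 ^ l)"
      by (intro slice_periodI[of _ 0]) simp
    then have "periodic_fun_simple (slice (Suc l)) (gcd (2 ^ j + 2 ^ l) (2 ^ Suc l))"
      using slice_period_power2 by (rule periodic_fun_simple_gcd)
    then show ?thesis
      by (simp only: gcd_sum_power2[OF \<open>j < l\<close>])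
  qed
qed

lemma slice_period_all_levels:
  assumes "j < k" and period: "periodic_fun_simple (slice k) (2 ^ j)" and "j \<le> l"
  shows "periodic_fun_simple (slice l) (2 ^ j)"
proof (cases "l \<le> k")
  case True
  then show ?thesis
    by (induction rule: inc_induct) (use period slice_period_coarser in auto)
next
  case False
  then have "k \<le> l"
    by simp
  then show ?thesis
    by (induction rule: dec_induct) (use assms slice_period_refine in auto)
qed

lemma slices_eq_imp_stable:
  assumes slice_eq: "slice k r = slice k s" and neq: "take_bit k r \<noteq> take_bit k s"
  obtains j where "stable_from j"
proof -
  have "periodic_fun_simple (slice k) (r - s)"
    using slice_eq by (intro slice_periodI[of _ s]) simp
  then have period: "periodic_fun_simple (slice k) (gcd (r - s) (2 ^ k))"
    using slice_period_power2 by (rule periodic_fun_simple_gcd)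
  obtain j where "j \<le> k" and gcd_eq: "gcd (r - s) (2 ^ k) = 2 ^ j"
    using divides_primepow[of "2::int" "gcd (r - s) (2 ^ k)" k] by auto
  moreover have "gcd (r - s) (2 ^ k) \<noteq> 2 ^ k"
    using neq by (metis gcd_dvd1 mod_eq_dvd_iff take_bit_eq_mod)
  ultimately have "j < k"
    by (metis le_neq_implies_less)
  then show thesis
    using slice_period_all_levels stable_from_if_periodic period gcd_eq that by metis
qed

end

section \<open>The shift\<close>

definition shift_by :: "int \<Rightarrow> (int \<Rightarrow> bool) \<Rightarrow> int \<Rightarrow> bool" where
  "shift_by j x = (\<lambda>i. x (i + j))"

lemma shiftS_eq_shift_by: "shiftS = shift_by 1"
  by (simp add: shiftS_def shift_by_def fun_eq_iff)

lemma shiftS_funpow: "shiftS ^^ n = shift_by (int n)"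
  by (induction n) (auto simp: shiftS_def shift_by_def fun_eq_iff algebra_simps)

lemma space_XZ [simp]: "space XZ = UNIV"
  by (simp add: XZ_def space_PiM)

interpretation shift: measurable_action XZ shift_by
proof
  show "shift_by j \<in> measurable XZ XZ" for j
    unfolding XZ_def shift_by_def by (rule measurable_PiM_single') (auto simp: space_PiM)
qed (simp_all add: shift_by_def algebra_simps)

lemma ergodic_odometer_extension_shift:
  assumes "\<nu> \<in> MM" "ergodic_SO \<nu>"
  shows "ergodic_odometer_extension XZ shift_by \<nu>"
proof -
  interpret prob_space \<nu>
    using assms(1) by (simp add: MM_def)
  show ?thesis
  proof
    show "sets \<nu> = sets (XZ \<Otimes>\<^sub>M XN)" "distr \<nu> (XZ \<Otimes>\<^sub>M XN) (map_prod (shift_by 1) odo) = \<nu>"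
      using assms(1) by (simp_all add: MM_def TSO_def shiftS_eq_shift_by)
    show "prob C = 0 \<or> prob C = 1"
      if "C \<in> sets \<nu>" "map_prod (shift_by 1) odo -` C \<inter> space \<nu> = C" for C
      using assms(2) that by (auto simp: ergodic_SO_def TSO_def shiftS_eq_shift_by measure_def)
  qed
qed

locale shift_odometer_extension = odometer_extension XZ shift_by \<nu> for \<nu>
begin

lemma Proj_eq_slice: "r < 2 ^ k \<Longrightarrow> Proj r k \<nu> = slice k (int r)"
  by (simp add: Proj_def slice_def uniform_measure_def Ark_eq_cylinder)

lemma periodic_type_of_stable:
  assumes stable: "stable_from j"
  shows "periodic_type \<nu>"
  unfolding periodic_type_def
proof (intro exI conjI ballI)
  interpret periodic_fun_simple "slice j" "2 ^ j"
    by (rule slice_period_power2)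
  show "distr (slice j 0) XZ (shiftS ^^ 2 ^ j) = slice j 0"
    using plus_period[of 0] by (simp add: shiftS_funpow distr_slice)
  show "emeasure \<nu> C = Dk_emeasure j (slice j 0) C" if "C \<in> sets (XZ \<Otimes>\<^sub>M XN)" for C
    using emeasure_eq_sum_pair_measures[OF stable, of C] that
    by (simp add: Dk_emeasure_def shiftS_funpow distr_slice Ark_eq_cylinder)
qed (simp_all add: prob_space_slice)

end

theorem theorem3:
  assumes "\<nu> \<in> MM" and "ergodic_SO \<nu>" and "aperiodic \<nu>"
  shows "\<forall>k r1 r2. r1 < 2^k \<and> r2 < 2^k \<and> r1 \<noteq> r2 \<longrightarrow>
           mutually_singular (Proj r1 k \<nu>) (Proj r2 k \<nu>)"
proof (intro allI impI, elim conjE)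
  fix k r1 r2 :: nat
  assume residues: "r1 < 2 ^ k" "r2 < 2 ^ k" "r1 \<noteq> r2"
  interpret ergodic_odometer_extension XZ shift_by \<nu>
    using assms(1,2) by (rule ergodic_odometer_extension_shift)
  interpret shift_odometer_extension \<nu> ..
  have "slice k (int r1) \<noteq> slice k (int r2)"
  proof
    assume "slice k (int r1) = slice k (int r2)"
    moreover have "take_bit k (int r1) \<noteq> take_bit k (int r2)"
      using residues by (simp add: take_bit_of_nat_less)
    ultimately obtain j where "stable_from j"
      by (rule slices_eq_imp_stable)
    then have "periodic_type \<nu>"
      by (rule periodic_type_of_stable)
    then show False
      using assms(3) by (simp add: aperiodic_def)
  qed
  then show "mutually_singular (Proj r1 k \<nu>) (Proj r2 k \<nu>)"
    using residues slices_eq_or_mutually_singular by (simp add: Proj_eq_slice) blast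
qed

end
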